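(* Let $n\ge 2$, let $\mathfrak{L}$ be a finite-dimensional Leibniz algebra over a field $\mathbb{K}$ of characteristic zero, and let $\mathfrak{L}=\mathfrak{g}\ltimes \mathrm{rad}(\mathfrak{L})$ be its Levi decomposition, where $\mathfrak{g}$ is a semisimple Lie subalgebra of $\mathfrak{L}$. Let $\mathfrak{g}=\bigoplus_{i=1}^m\mathfrak{g}_i$ be the decomposition of $\mathfrak{g}$ into simple Lie subalgebras. Then in the Leibniz $n$-algebra $\mathbf{U}_n(\mathfrak{L})$ the $k$-solvable radical coincides with $\mathrm{rad}(\mathfrak{L})$, i.e. $\mathrm{Rad}_k(\mathbf{U}_n(\mathfrak{L}))=\mathrm{rad}(\mathfrak{L})$, for all $2\le k\le n$, and there is the following analogue of the Levi decomposition: $$\mathbf{U}_n(\mathfrak{L})=\Bigl(\bigoplus_{i=1}^m \mathbf{U}_n(\mathfrak{g}_i)\Bigr)+\mathrm{Rad}(\mathbf{U}_n(\mathfrak{L})).$$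
   Context: A Leibniz algebra is a vector space $\mathfrak{L}$ with a bilinear bracket satisfying $[[x,y],z]=[[x,z],y]+[x,[y,z]]$. A subalgebra $K$ of $\mathfrak{L}$ is solvable if $K^{(m)}=\{0\}$ for some $m$, where $K^{(0)}=K$ and $K^{(j)}=[K^{(j-1)},K^{(j-1)}]$; $\mathrm{rad}(\mathfrak{L})$ is the maximal solvable ideal of $\mathfrak{L}$. By Barnes's theorem every finite-dimensional Leibniz algebra in characteristic zero has a Levi decomposition $\mathfrak{L}=\mathfrak{g}\ltimes\mathrm{rad}(\mathfrak{L})$ with $\mathfrak{g}$ a semisimple Lie subalgebra. A Leibniz $n$-algebra is a vector space $L$ with an $n$-linear bracket satisfying $[[x_1,\ldots,x_n],y_1,\ldots,y_{n-1}]=\sum_{i=1}^{n}[x_1,\ldots,x_{i-1},[x_i,y_1,\ldots,y_{n-1}],x_{i+1},\ldots,x_n]$. For a Leibniz algebra $\mathfrak{L}$, $\mathbf{U}_n(\mathfrak{L})$ is the Leibniz $n$-algebra on the same vector space with bracket $[x_1,\dots,x_n]=[x_1,[\dots,[x_{n-2},[x_{n-1},x_n]]\dots]]$. An ideal of a Leibniz $n$-algebra $L$ is a subspace $I$ such that for every $1\le s\le n$ one has $[L,\dots,L,I,L,\dots,L]\subseteq I$ with $I$ in position $s$. For an ideal $H$ of a Leibniz $n$-algebra $L$ and $1\le k\le n$, put $H^{(1)_k}=H$ and $$H^{(m+1)_k}=\sum_{i_1+\dots+i_k=0}^{n-k}[\underbrace{L,\dots,L}_{i_1},H^{(m)_k},\underbrace{L,\dots,L}_{i_2},H^{(m)_k},\dots,\underbrace{L,\dots,L}_{i_k},H^{(m)_k},L,\dots,L],$$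 i.e. the sum of the spans of all brackets in which $k$ of the $n$ positions are filled by $H^{(m)_k}$ and the remaining $n-k$ positions by $L$. The ideal $H$ is $k$-solvable if $H^{(m)_k}=0$ for some $m$, and solvable if it is $n$-solvable. $\mathrm{Rad}_k(L)$, the $k$-solvable radical, is the maximal $k$-solvable ideal of $L$, and $\mathrm{Rad}(L)=\mathrm{Rad}_n(L)$. *)

theory Defs
  imports Complex_Main "HOL-Library.Set_Algebras"
begin

text \<open>
  Algebras are given by a carrier, which is a subspace of an ambient vector space with scalar
  multiplication \<open>sc\<close>, and a bracket.  The subalgebra of \<open>L\<close> on a subspace \<open>S\<close> is
  \<open>L\<lparr>carrier := S\<rparr>\<close>.  Sums \<open>A + B\<close> and \<open>\<Sum>i\<in>I. S i\<close> of subspaces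
  are the elementwise ones of \<open>Set_Algebras\<close>.
\<close>

record 'v carrier_object =
  carrier :: "'v set"

record 'v lalg = "'v carrier_object" +
  bracket :: "'v \<Rightarrow> 'v \<Rightarrow> 'v"

text \<open>The bracket of an \<open>n\<close>-algebra takes its arguments as a list of length \<open>arity\<close>.\<close>

record 'v nalg = "'v carrier_object" +
  arity :: nat
  nbracket :: "'v list \<Rightarrow> 'v"

definition finite_dim :: "('k::field \<Rightarrow> 'v::ab_group_add \<Rightarrow> 'v) \<Rightarrow> 'v set \<Rightarrow> bool" where
  "finite_dim sc V \<longleftrightarrow> (\<exists>B. finite B \<and> V = module.span sc B)"

text \<open>A finite family of subspaces whose sum is direct.\<close>

definition independent_family :: "'i set \<Rightarrow> ('i \<Rightarrow> 'v::comm_monoid_add set) \<Rightarrow> bool" where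
  "independent_family I S \<longleftrightarrow>
     (\<forall>f. (\<forall>i\<in>I. f i \<in> S i) \<longrightarrow> (\<Sum>i\<in>I. f i) = 0 \<longrightarrow> (\<forall>i\<in>I. f i = 0))"


section \<open>Leibniz algebras\<close>

locale leibniz_algebra = vector_space sc
  for sc :: "'k::field \<Rightarrow> 'v::ab_group_add \<Rightarrow> 'v" +
  fixes L :: "'v lalg"
  assumes subspace_carrier: "module.subspace sc (carrier L)"
    and bracket_closed: "\<lbrakk>x \<in> carrier L; y \<in> carrier L\<rbrakk> \<Longrightarrow> bracket L x y \<in> carrier L"
    and bracket_add_left: "\<lbrakk>x \<in> carrier L; y \<in> carrier L; z \<in> carrier L\<rbrakk> \<Longrightarrow>
          bracket L (x + y) z = bracket L x z + bracket L y z"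
    and bracket_add_right: "\<lbrakk>x \<in> carrier L; y \<in> carrier L; z \<in> carrier L\<rbrakk> \<Longrightarrow>
          bracket L x (y + z) = bracket L x y + bracket L x z"
    and bracket_scale_left: "\<lbrakk>x \<in> carrier L; y \<in> carrier L\<rbrakk> \<Longrightarrow>
          bracket L (sc c x) y = sc c (bracket L x y)"
    and bracket_scale_right: "\<lbrakk>x \<in> carrier L; y \<in> carrier L\<rbrakk> \<Longrightarrow>
          bracket L x (sc c y) = sc c (bracket L x y)"
    and leibniz: "\<lbrakk>x \<in> carrier L; y \<in> carrier L; z \<in> carrier L\<rbrakk> \<Longrightarrow>
          bracket L (bracket L x y) z = bracket L (bracket L x z) y + bracket L x (bracket L y z)"

text \<open>Given an alternating bracket, the Leibniz identity is the Jacobi identity.\<close>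

locale lie_algebra = leibniz_algebra +
  assumes bracket_self: "x \<in> carrier L \<Longrightarrow> bracket L x x = 0"

definition subalgebra ::
    "('k::field \<Rightarrow> 'v::ab_group_add \<Rightarrow> 'v) \<Rightarrow> 'v lalg \<Rightarrow> 'v set \<Rightarrow> bool" where
  "subalgebra sc L S \<longleftrightarrow> module.subspace sc S \<and> S \<subseteq> carrier L \<and>
     (\<forall>x\<in>S. \<forall>y\<in>S. bracket L x y \<in> S)"

definition ideal ::
    "('k::field \<Rightarrow> 'v::ab_group_add \<Rightarrow> 'v) \<Rightarrow> 'v lalg \<Rightarrow> 'v set \<Rightarrow> bool" where
  "ideal sc L I \<longleftrightarrow> module.subspace sc I \<and> I \<subseteq> carrier L \<and>
     (\<forall>x\<in>I. \<forall>y\<in>carrier L. bracket L x y \<in> I \<and> bracket L y x \<in> I)"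

primrec derived_series ::
    "('k::field \<Rightarrow> 'v::ab_group_add \<Rightarrow> 'v) \<Rightarrow> 'v lalg \<Rightarrow> 'v set \<Rightarrow> nat \<Rightarrow> 'v set" where
  "derived_series sc L K 0 = K"
| "derived_series sc L K (Suc j) = module.span sc
     {bracket L x y | x y. x \<in> derived_series sc L K j \<and> y \<in> derived_series sc L K j}"

definition solvable ::
    "('k::field \<Rightarrow> 'v::ab_group_add \<Rightarrow> 'v) \<Rightarrow> 'v lalg \<Rightarrow> 'v set \<Rightarrow> bool" where
  "solvable sc L K \<longleftrightarrow> (\<exists>m. derived_series sc L K m = {0})"

definition is_radical ::
    "('k::field \<Rightarrow> 'v::ab_group_add \<Rightarrow> 'v) \<Rightarrow> 'v lalg \<Rightarrow> 'v set \<Rightarrow> bool" where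
  "is_radical sc L R \<longleftrightarrow> ideal sc L R \<and> solvable sc L R \<and>
     (\<forall>I. ideal sc L I \<and> solvable sc L I \<longrightarrow> I \<subseteq> R)"

definition rad :: "('k::field \<Rightarrow> 'v::ab_group_add \<Rightarrow> 'v) \<Rightarrow> 'v lalg \<Rightarrow> 'v set" where
  "rad sc L = (THE R. is_radical sc L R)"

text \<open>The zero Lie algebra counts as semisimple (it is the Levi factor of a solvable algebra).\<close>

definition semisimple ::
    "('k::field \<Rightarrow> 'v::ab_group_add \<Rightarrow> 'v) \<Rightarrow> 'v lalg \<Rightarrow> bool" where
  "semisimple sc L \<longleftrightarrow> lie_algebra sc L \<and> is_radical sc L {0}"

definition simple ::
    "('k::field \<Rightarrow> 'v::ab_group_add \<Rightarrow> 'v) \<Rightarrow> 'v lalg \<Rightarrow> bool" where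
  "simple sc L \<longleftrightarrow> lie_algebra sc L \<and>
     (\<exists>x\<in>carrier L. \<exists>y\<in>carrier L. bracket L x y \<noteq> 0) \<and>
     (\<forall>I. ideal sc L I \<longrightarrow> I = {0} \<or> I = carrier L)"

definition levi_decomposition ::
    "('k::field \<Rightarrow> 'v::ab_group_add \<Rightarrow> 'v) \<Rightarrow> 'v lalg \<Rightarrow> 'v set \<Rightarrow> bool" where
  "levi_decomposition sc L G \<longleftrightarrow>
     subalgebra sc L G \<and> semisimple sc (L\<lparr>carrier := G\<rparr>) \<and>
     carrier L = G + rad sc L \<and> G \<inter> rad sc L = {0}"

text \<open>The direct sum of the algebras \<open>B i\<close>, with componentwise bracket, sits inside \<open>A\<close>.\<close>

definition direct_sum_in ::
    "('k::field \<Rightarrow> 'v::ab_group_add \<Rightarrow> 'v) \<Rightarrow> 'v lalg \<Rightarrow> 'i set \<Rightarrow> ('i \<Rightarrow> 'v lalg) \<Rightarrow> bool" where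
  "direct_sum_in sc A I B \<longleftrightarrow>
     (\<forall>i\<in>I. leibniz_algebra sc (B i) \<and> carrier (B i) \<subseteq> carrier A) \<and>
     independent_family I (\<lambda>i. carrier (B i)) \<and>
     (\<forall>f g. (\<forall>i\<in>I. f i \<in> carrier (B i) \<and> g i \<in> carrier (B i)) \<longrightarrow>
        bracket A (\<Sum>i\<in>I. f i) (\<Sum>i\<in>I. g i) = (\<Sum>i\<in>I. bracket (B i) (f i) (g i)))"


section \<open>Leibniz \<open>n\<close>-algebras\<close>

text \<open>In the \<open>n\<close>-ary Leibniz identity the list \<open>ys\<close> is \<open>y\<^sub>1, \<dots>, y\<^sub>n\<^sub>-\<^sub>1\<close>.\<close>

locale leibniz_n_algebra = vector_space sc
  for sc :: "'k::field \<Rightarrow> 'v::ab_group_add \<Rightarrow> 'v" +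
  fixes A :: "'v nalg"
  assumes nsubspace_carrier: "module.subspace sc (carrier A)"
    and nbracket_closed: "\<lbrakk>length xs = arity A; set xs \<subseteq> carrier A\<rbrakk> \<Longrightarrow>
          nbracket A xs \<in> carrier A"
    and nbracket_add: "\<lbrakk>length xs = arity A; set xs \<subseteq> carrier A; s < arity A;
            x \<in> carrier A; y \<in> carrier A\<rbrakk> \<Longrightarrow>
          nbracket A (xs[s := x + y]) = nbracket A (xs[s := x]) + nbracket A (xs[s := y])"
    and nbracket_scale: "\<lbrakk>length xs = arity A; set xs \<subseteq> carrier A; s < arity A;
            x \<in> carrier A\<rbrakk> \<Longrightarrow>
          nbracket A (xs[s := sc c x]) = sc c (nbracket A (xs[s := x]))"
    and nleibniz: "\<lbrakk>length xs = arity A; set xs \<subseteq> carrier A;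
            Suc (length ys) = arity A; set ys \<subseteq> carrier A\<rbrakk> \<Longrightarrow>
          nbracket A (nbracket A xs # ys) =
            (\<Sum>i<arity A. nbracket A (xs[i := nbracket A (xs ! i # ys)]))"

text \<open>\<open>[x\<^sub>1, [\<dots>, [x\<^sub>n\<^sub>-\<^sub>1, x\<^sub>n] \<dots>]]\<close>; the value on the empty list is irrelevant.\<close>

fun iterated_bracket :: "('v::zero \<Rightarrow> 'v \<Rightarrow> 'v) \<Rightarrow> 'v list \<Rightarrow> 'v" where
  "iterated_bracket b [] = 0"
| "iterated_bracket b [x] = x"
| "iterated_bracket b (x # y # zs) = b x (iterated_bracket b (y # zs))"

definition U :: "nat \<Rightarrow> 'v::zero lalg \<Rightarrow> 'v nalg" where
  "U n L = \<lparr>carrier = carrier L, arity = n, nbracket = iterated_bracket (bracket L)\<rparr>"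

definition n_ideal ::
    "('k::field \<Rightarrow> 'v::ab_group_add \<Rightarrow> 'v) \<Rightarrow> 'v nalg \<Rightarrow> 'v set \<Rightarrow> bool" where
  "n_ideal sc A I \<longleftrightarrow> module.subspace sc I \<and> I \<subseteq> carrier A \<and>
     (\<forall>xs s. length xs = arity A \<and> set xs \<subseteq> carrier A \<and> s < arity A \<and> xs ! s \<in> I \<longrightarrow>
        nbracket A xs \<in> I)"

text \<open>
  \<open>k_series sc A k H m\<close> is \<open>H\<^sup>(\<^sup>m\<^sup>+\<^sup>1\<^sup>)\<close> for the given \<open>k\<close>: the usual numbering starts at 1,
  this one at 0.  The set \<open>P\<close> consists of the \<open>k\<close> positions occupied by the previous term.
\<close>

primrec k_series ::
    "('k::field \<Rightarrow> 'v::ab_group_add \<Rightarrow> 'v) \<Rightarrow> 'v nalg \<Rightarrow> nat \<Rightarrow> 'v set \<Rightarrow> nat \<Rightarrow> 'v set" where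
  "k_series sc A k H 0 = H"
| "k_series sc A k H (Suc m) = module.span sc
     {nbracket A xs | xs P. length xs = arity A \<and> P \<subseteq> {..<arity A} \<and> card P = k \<and>
        (\<forall>i<arity A. xs ! i \<in> (if i \<in> P then k_series sc A k H m else carrier A))}"

definition k_solvable ::
    "('k::field \<Rightarrow> 'v::ab_group_add \<Rightarrow> 'v) \<Rightarrow> 'v nalg \<Rightarrow> nat \<Rightarrow> 'v set \<Rightarrow> bool" where
  "k_solvable sc A k H \<longleftrightarrow> (\<exists>m. k_series sc A k H m = {0})"

definition is_k_radical ::
    "('k::field \<Rightarrow> 'v::ab_group_add \<Rightarrow> 'v) \<Rightarrow> 'v nalg \<Rightarrow> nat \<Rightarrow> 'v set \<Rightarrow> bool" where
  "is_k_radical sc A k R \<longleftrightarrow> n_ideal sc A R \<and> k_solvable sc A k R \<and>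
     (\<forall>H. n_ideal sc A H \<and> k_solvable sc A k H \<longrightarrow> H \<subseteq> R)"

definition k_Rad ::
    "('k::field \<Rightarrow> 'v::ab_group_add \<Rightarrow> 'v) \<Rightarrow> nat \<Rightarrow> 'v nalg \<Rightarrow> 'v set" where
  "k_Rad sc k A = (THE R. is_k_radical sc A k R)"

definition Rad :: "('k::field \<Rightarrow> 'v::ab_group_add \<Rightarrow> 'v) \<Rightarrow> 'v nalg \<Rightarrow> 'v set" where
  "Rad sc A = k_Rad sc (arity A) A"

text \<open>The direct sum of the \<open>n\<close>-algebras \<open>B i\<close>, with componentwise bracket, sits inside \<open>A\<close>.
  A list \<open>fs\<close> of families \<open>f\<close> encodes the list of the elements \<open>\<Sum>i\<in>I. f i\<close>.\<close>

definition n_direct_sum_in ::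
    "('k::field \<Rightarrow> 'v::ab_group_add \<Rightarrow> 'v) \<Rightarrow> 'v nalg \<Rightarrow> 'i set \<Rightarrow> ('i \<Rightarrow> 'v nalg) \<Rightarrow> bool" where
  "n_direct_sum_in sc A I B \<longleftrightarrow>
     (\<forall>i\<in>I. leibniz_n_algebra sc (B i) \<and> arity (B i) = arity A \<and> carrier (B i) \<subseteq> carrier A) \<and>
     independent_family I (\<lambda>i. carrier (B i)) \<and>
     (\<forall>fs. length fs = arity A \<and> (\<forall>f\<in>set fs. \<forall>i\<in>I. f i \<in> carrier (B i)) \<longrightarrow>
        nbracket A (map (\<lambda>f. \<Sum>i\<in>I. f i) fs) = (\<Sum>i\<in>I. nbracket (B i) (map (\<lambda>f. f i) fs)))"


section \<open>Well-definedness\<close>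

lemma rad_eqI: "is_radical sc L R \<Longrightarrow> rad sc L = R"
  unfolding rad_def is_radical_def by (rule the_equality) blast+

lemma k_Rad_eqI: "is_k_radical sc A k R \<Longrightarrow> k_Rad sc k A = R"
  unfolding k_Rad_def is_k_radical_def by (rule the_equality) blast+

context leibniz_algebra
begin

lemma iterated_bracket_closed:
  "xs \<noteq> [] \<Longrightarrow> set xs \<subseteq> carrier L \<Longrightarrow> iterated_bracket (bracket L) xs \<in> carrier L"
  by (induction "bracket L" xs rule: iterated_bracket.induct) (auto intro: bracket_closed)

lemma iterated_bracket_Cons:
  "xs \<noteq> [] \<Longrightarrow> iterated_bracket b (x # xs) = b x (iterated_bracket b xs)"
  by (cases xs) auto

lemma bracket_zero_left: "y \<in> carrier L \<Longrightarrow> bracket L 0 y = 0"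
  using bracket_scale_left[of 0 y 0] subspace_0[OF subspace_carrier] by simp

lemma bracket_zero_right: "y \<in> carrier L \<Longrightarrow> bracket L y 0 = 0"
  using bracket_scale_right[of y 0 0] subspace_0[OF subspace_carrier] by simp

lemma bracket_sum_right:
  assumes "finite I" "x \<in> carrier L" "\<And>i. i \<in> I \<Longrightarrow> f i \<in> carrier L"
  shows "bracket L x (\<Sum>i\<in>I. f i) = (\<Sum>i\<in>I. bracket L x (f i))"
  using assms
  by (induction I rule: finite_induct)
     (auto simp: bracket_zero_right bracket_add_right subspace_sum[OF subspace_carrier])

lemma set_update: "set xs \<subseteq> C \<Longrightarrow> x \<in> C \<Longrightarrow> set (xs[s := x]) \<subseteq> C"
  using set_update_subset_insert[of xs s x] by blast

lemma iterated_bracket_add: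
  assumes "set xs \<subseteq> carrier L" "s < length xs" "x \<in> carrier L" "y \<in> carrier L"
  shows "iterated_bracket (bracket L) (xs[s := x + y]) =
    iterated_bracket (bracket L) (xs[s := x]) + iterated_bracket (bracket L) (xs[s := y])"
  using assms
proof (induction xs arbitrary: s)
  case (Cons a xs)
  show ?case
  proof (cases "xs = []")
    case False
    show ?thesis
    proof (cases s)
      case 0
      then show ?thesis
        using Cons.prems False
        by (simp add: iterated_bracket_Cons bracket_add_left iterated_bracket_closed)
    next
      case (Suc t)
      then show ?thesis
        using Cons.prems Cons.IH[of t] False
        by (simp add: iterated_bracket_Cons bracket_add_right iterated_bracket_closed set_update)
    qed
  qed (use Cons.prems in simp)
qed simp

lemma iterated_bracket_scale:
  assumes "set xs \<subseteq> carrier L" "s < length xs" "x \<in> carrier L"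
  shows "iterated_bracket (bracket L) (xs[s := sc c x]) =
    sc c (iterated_bracket (bracket L) (xs[s := x]))"
  using assms
proof (induction xs arbitrary: s)
  case (Cons a xs)
  show ?case
  proof (cases "xs = []")
    case False
    show ?thesis
    proof (cases s)
      case 0
      then show ?thesis
        using Cons.prems False
        by (simp add: iterated_bracket_Cons bracket_scale_left iterated_bracket_closed)
    next
      case (Suc t)
      then show ?thesis
        using Cons.prems Cons.IH[of t] False
        by (simp add: iterated_bracket_Cons bracket_scale_right iterated_bracket_closed set_update)
    qed
  qed (use Cons.prems in simp)
qed simp

lemma iterated_bracket_derivation:
  assumes "set xs \<subseteq> carrier L" "xs \<noteq> []" "w \<in> carrier L"
  shows "bracket L (iterated_bracket (bracket L) xs) w =
    (\<Sum>i<length xs. iterated_bracket (bracket L) (xs[i := bracket L (xs ! i) w]))"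
  using assms
proof (induction xs)
  case (Cons a xs)
  show ?case
  proof (cases "xs = []")
    case False
    let ?b = "iterated_bracket (bracket L)"
    have c: "a \<in> carrier L" "set xs \<subseteq> carrier L" "?b xs \<in> carrier L"
      using Cons.prems False by (auto intro: iterated_bracket_closed)
    have u: "?b (xs[i := bracket L (xs ! i) w]) \<in> carrier L" if "i < length xs" for i
    proof -
      have "xs ! i \<in> carrier L" using that c by auto
      then show ?thesis
        using that c Cons.prems False
        by (intro iterated_bracket_closed set_update) (auto intro: bracket_closed)
    qed
    have "bracket L (?b (a # xs)) w = bracket L (bracket L a w) (?b xs) +
        bracket L a (bracket L (?b xs) w)"
      using leibniz[OF c(1) c(3) Cons.prems(3)] False by (simp add: iterated_bracket_Cons)
    also have "bracket L (?b xs) w = (\<Sum>i<length xs. ?b (xs[i := bracket L (xs ! i) w]))"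
      using Cons.IH c False Cons.prems by simp
    also have "bracket L a \<dots> = (\<Sum>i<length xs. bracket L a (?b (xs[i := bracket L (xs ! i) w])))"
      using c u by (intro bracket_sum_right) auto
    finally show ?thesis
      using False by (simp add: sum.lessThan_Suc_shift iterated_bracket_Cons del: sum.lessThan_Suc)
  qed simp
qed simp

theorem U_leibniz_n_algebra:
  assumes "2 \<le> n"
  shows "leibniz_n_algebra sc (U n L)"
proof
  fix xs ys :: "'v list"
  assume h: "length xs = arity (U n L)" "set xs \<subseteq> carrier (U n L)"
    "Suc (length ys) = arity (U n L)" "set ys \<subseteq> carrier (U n L)"
  let ?b = "iterated_bracket (bracket L)"
  have ne: "xs \<noteq> []" "ys \<noteq> []" using h assms by (auto simp: U_def)
  have w: "?b ys \<in> carrier L" using h ne by (auto simp: U_def intro: iterated_bracket_closed)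
  show "nbracket (U n L) (nbracket (U n L) xs # ys) =
      (\<Sum>i<arity (U n L). nbracket (U n L) (xs[i := nbracket (U n L) (xs ! i # ys)]))"
    using iterated_bracket_derivation[OF _ ne(1) w] h ne
    by (simp add: U_def iterated_bracket_Cons)
next
  fix xs :: "'v list"
  assume "length xs = arity (U n L)" "set xs \<subseteq> carrier (U n L)"
  then show "nbracket (U n L) xs \<in> carrier (U n L)"
    using assms by (auto simp: U_def intro!: iterated_bracket_closed)
qed (auto simp: U_def subspace_carrier iterated_bracket_add iterated_bracket_scale)

lemma derived_series_subset:
  assumes "subalgebra sc L K"
  shows "derived_series sc L K m \<subseteq> K"
proof (induction m)
  case (Suc m)
  then show ?case
    using assms unfolding subalgebra_def derived_series.simps
    by (intro span_minimal) blast+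
qed simp

lemma ideal_subalgebra: "ideal sc L I \<Longrightarrow> subalgebra sc L I"
  unfolding ideal_def subalgebra_def by blast

lemma set_plus_eq: "(A :: 'v set) + B = {x + y |x y. x \<in> A \<and> y \<in> B}"
  by (auto simp: set_plus_def)

lemma subspace_set_plus: "subspace A \<Longrightarrow> subspace B \<Longrightarrow> subspace (A + B)"
  unfolding set_plus_eq by (rule subspace_sums)

lemma ideal_sum:
  assumes "ideal sc L I" "ideal sc L J"
  shows "ideal sc L (I + J)"
proof -
  have s: "subspace I" "subspace J" "I \<subseteq> carrier L" "J \<subseteq> carrier L"
    using assms by (auto simp: ideal_def)
  have eq: "I + J = {x + y |x y. x \<in> I \<and> y \<in> J}"
    by (rule set_plus_eq)
  have "subspace (I + J)"
    by (rule subspace_set_plus[OF s(1,2)])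
  moreover have "I + J \<subseteq> carrier L"
    unfolding eq using s subspace_add[OF subspace_carrier] by blast
  moreover have "bracket L x y \<in> I + J \<and> bracket L y x \<in> I + J"
    if xy: "x \<in> I + J" "y \<in> carrier L" for x y
  proof -
    obtain a b where x: "x = a + b" "a \<in> I" "b \<in> J"
      using xy(1) unfolding eq by blast
    then have c: "a \<in> carrier L" "b \<in> carrier L" using s by auto
    show ?thesis
      using assms x c xy(2) unfolding ideal_def
      by (auto simp: x(1) bracket_add_left bracket_add_right intro!: set_plus_intro)
  qed
  ultimately show ?thesis unfolding ideal_def by blast
qed

lemma derived_series_mono:
  "A \<subseteq> B \<Longrightarrow> derived_series sc L A m \<subseteq> derived_series sc L B m"
proof (induction m)
  case (Suc m)
  then show ?case unfolding derived_series.simps by (intro span_mono) blast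
qed simp

lemma derived_series_add:
  "derived_series sc L K (i + j) = derived_series sc L (derived_series sc L K i) j"
  by (induction j) simp_all

lemma derived_series_sum:
  assumes "ideal sc L I" "ideal sc L J"
  shows "derived_series sc L (I + J) m \<subseteq> derived_series sc L I m + J"
proof (induction m)
  case (Suc m)
  let ?D = "derived_series sc L"
  have J: "subspace J" "J \<subseteq> carrier L" using assms by (auto simp: ideal_def)
  have D: "?D I m \<subseteq> carrier L"
    using derived_series_subset[OF ideal_subalgebra[OF assms(1)]] assms(1)
    by (auto simp: ideal_def)
  have sub: "subspace (?D I (Suc m) + J)"
    unfolding derived_series.simps by (rule subspace_set_plus[OF subspace_span J(1)])
  show ?case
    unfolding derived_series.simps(2)[of sc L "I + J"]
  proof (rule span_minimal[OF _ sub], safe)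
    fix x y assume xy: "x \<in> ?D (I + J) m" "y \<in> ?D (I + J) m"
    obtain a b c d where e: "x = a + b" "y = c + d" "a \<in> ?D I m" "c \<in> ?D I m" "b \<in> J" "d \<in> J"
      using subsetD[OF Suc xy(1)] subsetD[OF Suc xy(2)] unfolding set_plus_eq by blast
    then have c: "a \<in> carrier L" "b \<in> carrier L" "c \<in> carrier L" "d \<in> carrier L"
      using D J by auto
    have "bracket L x y = bracket L a c + (bracket L a d + bracket L b (c + d))"
      using c by (simp add: e bracket_add_left bracket_add_right subspace_add[OF subspace_carrier])
    moreover have "bracket L a c \<in> ?D I (Suc m)" using e by (auto intro!: span_base)
    moreover have "bracket L a d + bracket L b (c + d) \<in> J"
      using assms(2) e c unfolding ideal_def
      by (intro subspace_add[OF J(1)]) (auto simp: subspace_add[OF subspace_carrier])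
    ultimately show "bracket L x y \<in> ?D I (Suc m) + J" by (metis set_plus_intro)
  qed
qed simp

lemma solvable_sum:
  assumes "ideal sc L I" "solvable sc L I" "ideal sc L J" "solvable sc L J"
  shows "solvable sc L (I + J)"
proof -
  let ?D = "derived_series sc L"
  obtain m k where m: "?D I m = {0}" and k: "?D J k = {0}"
    using assms by (auto simp: solvable_def)
  have "?D (I + J) m \<subseteq> J"
    using derived_series_sum[OF assms(1,3), of m] m by (auto simp: set_plus_def)
  from derived_series_mono[OF this, of k] have "?D (I + J) (m + k) \<subseteq> {0}"
    by (simp add: k derived_series_add)
  moreover have "0 \<in> ?D (I + J) (m + k)"
    using ideal_sum[OF assms(1,3)] by (cases "m + k") (auto simp: ideal_def subspace_0 span_zero)
  ultimately show ?thesis unfolding solvable_def by blast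
qed

theorem is_radical_rad:
  assumes "finite_dim sc (carrier L)"
  shows "is_radical sc L (rad sc L)"
proof -
  obtain B where B: "finite B" "carrier L = span B"
    using assms by (auto simp: finite_dim_def)
  let ?P = "\<lambda>I. ideal sc L I \<and> solvable sc L I"
  have fin: "finite C \<and> card C \<le> card B" if "independent C" "C \<subseteq> carrier L" for C
    using independent_span_bound[OF B(1) that(1)] that(2) B(2) by auto
  have "ideal sc L {0}"
    by (auto simp: ideal_def subspace_0[OF subspace_carrier] bracket_zero_left bracket_zero_right)
  then have P0: "?P {0}" by (auto simp: solvable_def intro!: exI[of _ 0])
  let ?Q = "\<lambda>k. \<exists>C. independent C \<and> card C = k \<and> ?P (span C)"
  have Q0: "?Q 0" using P0 by (intro exI[of _ "{}"]) (auto simp: independent_empty)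
  have bound: "k \<le> card B" if k: "?Q k" for k
  proof -
    obtain C where C: "independent C" "card C = k" "?P (span C)" using k by blast
    then have "C \<subseteq> carrier L" using span_superset[of C] unfolding ideal_def by blast
    then show ?thesis using fin[of C] C by simp
  qed
  define k where "k = (GREATEST k. ?Q k)"
  have k: "j \<le> k" if "?Q j" for j
    unfolding k_def by (rule Greatest_le_nat[of ?Q, OF that bound])
  have "?Q k"
    unfolding k_def by (rule GreatestI_nat[of ?Q, OF Q0 bound])
  then obtain C where C: "independent C" "card C = k" "?P (span C)" by blast
  have "J \<subseteq> span C" if "?P J" for J
  proof -
    have IJ: "?P (span C + J)"
      using C that ideal_sum solvable_sum by blast
    have zero: "0 \<in> J" using that subspace_0 by (auto simp: ideal_def)
    have sub: "span C \<subseteq> span C + J" "J \<subseteq> span C + J"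
      using set_plus_intro[OF _ zero, of _ "span C"] set_plus_intro[OF span_zero[of C], of _ J] by auto
    then have "C \<subseteq> span C + J" using span_superset by blast
    then obtain E where E: "C \<subseteq> E" "E \<subseteq> span C + J" "independent E" "span C + J \<subseteq> span E"
      using maximal_independent_subset_extend[OF _ C(1)] by metis
    have eq: "span E = span C + J"
      using E IJ by (intro span_subspace) (auto simp: ideal_def)
    then have "card E \<le> k" using E IJ by (intro k exI[of _ E]) simp
    moreover have "finite E" using fin[OF E(3)] E(2) IJ unfolding ideal_def by blast
    ultimately have "C = E" using E(1) C(2) by (intro card_seteq) simp_all
    then show ?thesis using eq sub by simp
  qed
  then have "is_radical sc L (span C)" using C unfolding is_radical_def by blast
  then show ?thesis using rad_eqI[of sc L "span C"] by simp
qed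

end

end

theory Submission
  imports Defs
begin

text \<open>
  Write \<open>R\<close> for the radical of \<open>L\<close>, and call \<open>[x\<^sub>1, [\<dots>, [x\<^sub>n\<^sub>-\<^sub>1, x\<^sub>n] \<dots>]]\<close> a nested bracket.

  \<^emph>\<open>\<open>R\<close> is a \<open>k\<close>-solvable \<open>n\<close>-ideal.\<close>  The terms of the derived series of \<open>R\<close> are ideals
  of \<open>L\<close> (\<open>ideal_derived_series\<close>).  A nested bracket with two entries in an ideal \<open>I\<close> lies in
  \<open>[I, I]\<close> (\<open>iterated_bracket_two_in_ideal\<close>): strip the entries in front of the first one in \<open>I\<close>,
  which is harmless because \<open>[I, I]\<close> is an ideal; what is left is the bracket of an element of \<open>I\<close>
  with a nested bracket that has another entry in \<open>I\<close>.  So for \<open>k \<ge> 2\<close> the \<open>k\<close>-series of \<open>R\<close> is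
  dominated by its derived series.

  \<^emph>\<open>Every \<open>k\<close>-solvable \<open>n\<close>-ideal \<open>H\<close> lies in \<open>R\<close>.\<close>  In general \<open>H\<close> is not an ideal of \<open>L\<close>, but its
  image in each simple quotient is one.  Let \<open>K\<^sub>i\<close> be the sum of \<open>R\<close> and of all the simple
  components except \<open>S = g\<^sub>i\<close>.  It is an ideal with \<open>L = S + K\<^sub>i\<close>, and the intersection of all
  the \<open>K\<^sub>i\<close> is \<open>R\<close>, so it suffices to show \<open>H \<subseteq> K\<^sub>i\<close> (\<open>k_solvable_subset_ideal\<close>).  Let \<open>J\<close> be
  the set of elements of \<open>S\<close> that are congruent to an element of \<open>H\<close> modulo \<open>K\<^sub>i\<close>; a nested
  bracket of length \<open>n\<close> in \<open>S\<close> with last entry in \<open>J\<close> lies in \<open>J\<close>.  As \<open>S = [S, S]\<close>, the identity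
  \<open>[[a, b], y] = [a, [b, y]] - [b, [a, y]]\<close> expresses shorter nested brackets by longer ones, so
  \<open>J\<close> absorbs even plain brackets and is an ideal of \<open>S\<close> (\<open>simple_absorbing_subspace\<close>).
  If \<open>J = 0\<close> then \<open>H \<subseteq> K\<^sub>i\<close>.  If \<open>J = S\<close> then every element of \<open>S\<close> is congruent to one of \<open>H\<close>,
  and since \<open>S\<close> is spanned by nested brackets of length \<open>n\<close>, the same follows for
  every term of the \<open>k\<close>-series of \<open>H\<close>; then that series does not reach \<open>0\<close>.

  The decomposition of \<open>U n L\<close> is the Levi decomposition of \<open>L\<close>; componentwise brackets nest to
  componentwise brackets.
\<close>

section \<open>Nested brackets and ideals\<close>

context leibniz_algebra
begin

abbreviation nested :: "'v list \<Rightarrow> 'v" where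
  "nested \<equiv> iterated_bracket (bracket L)"

lemma bracket_span_left:
  assumes "x \<in> span A" "A \<subseteq> carrier L" "y \<in> carrier L" "subspace D"
    and "\<And>a. a \<in> A \<Longrightarrow> bracket L a y \<in> D"
  shows "bracket L x y \<in> D"
proof -
  have "subspace {x \<in> carrier L. bracket L x y \<in> D}"
    using assms(3,4) subspace_carrier unfolding subspace_def
    by (auto simp: bracket_add_left bracket_scale_left bracket_zero_left)
  then have "span A \<subseteq> {x \<in> carrier L. bracket L x y \<in> D}"
    using assms by (intro span_minimal) auto
  then show ?thesis using assms by auto
qed

lemma bracket_span_right:
  assumes "x \<in> span A" "A \<subseteq> carrier L" "y \<in> carrier L" "subspace D"
    and "\<And>a. a \<in> A \<Longrightarrow> bracket L y a \<in> D"
  shows "bracket L y x \<in> D"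
proof -
  have "subspace {x \<in> carrier L. bracket L y x \<in> D}"
    using assms(3,4) subspace_carrier unfolding subspace_def
    by (auto simp: bracket_add_right bracket_scale_right bracket_zero_right)
  then have "span A \<subseteq> {x \<in> carrier L. bracket L y x \<in> D}"
    using assms by (intro span_minimal) auto
  then show ?thesis using assms by auto
qed

lemma bracket_diff:
  assumes "a \<in> carrier L" "b \<in> carrier L" "x \<in> carrier L" "y \<in> carrier L"
  shows "bracket L a x - bracket L b y = bracket L (a - b) x + bracket L b (x - y)"
proof -
  have c: "a - b \<in> carrier L" "x - y \<in> carrier L"
    using assms subspace_diff[OF subspace_carrier] by auto
  have "bracket L a x = bracket L (a - b) x + bracket L b x"
    using bracket_add_left[of "a - b" b x] assms c by simp
  moreover have "bracket L b x = bracket L b (x - y) + bracket L b y"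
    using bracket_add_right[of b "x - y" y] assms c by simp
  ultimately show ?thesis by simp
qed

lemma iterated_bracket_in_ideal:
  assumes "ideal sc L I" "set xs \<subseteq> carrier L" "i < length xs" "xs ! i \<in> I"
  shows "nested xs \<in> I"
  using assms(2-)
proof (induction xs arbitrary: i)
  case (Cons a xs)
  show ?case
  proof (cases "xs = []")
    case False
    then have "nested xs \<in> carrier L"
      using Cons.prems by (intro iterated_bracket_closed) auto
    moreover have "i \<noteq> 0 \<Longrightarrow> nested xs \<in> I"
      using Cons.prems Cons.IH[of "i - 1"] by (auto simp: nth_Cons')
    ultimately show ?thesis
      using assms(1) Cons.prems False unfolding ideal_def
      by (cases "i = 0") (auto simp: iterated_bracket_Cons)
  qed (use Cons.prems in auto)
qed simp

text \<open>Both halves are the Leibniz identity, read as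
  \<open>[[x, y], z] = [[x, z], y] + [x, [y, z]]\<close> and as \<open>[z, [x, y]] = [[z, x], y] - [[z, y], x]\<close>.\<close>

lemma ideal_span_brackets:
  assumes "ideal sc L I"
  shows "ideal sc L (span {bracket L x y | x y. x \<in> I \<and> y \<in> I})"
proof -
  let ?A = "{bracket L x y | x y. x \<in> I \<and> y \<in> I}"
  have I: "x \<in> carrier L" "\<And>z. z \<in> carrier L \<Longrightarrow> bracket L x z \<in> I"
    "\<And>z. z \<in> carrier L \<Longrightarrow> bracket L z x \<in> I" if "x \<in> I" for x
    using assms that unfolding ideal_def by auto
  have base: "bracket L x y \<in> span ?A" if "x \<in> I" "y \<in> I" for x y
    using that by (intro span_base) blast
  have A: "?A \<subseteq> carrier L" using I(1) bracket_closed by blast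
  have "bracket L x z \<in> span ?A \<and> bracket L z x \<in> span ?A"
    if x: "x \<in> span ?A" and z: "z \<in> carrier L" for x z
  proof
    show "bracket L x z \<in> span ?A"
      using x A z subspace_span
    proof (rule bracket_span_left)
      fix a assume "a \<in> ?A"
      then obtain u v where a: "a = bracket L u v" "u \<in> I" "v \<in> I" by blast
      show "bracket L a z \<in> span ?A"
        unfolding a(1) leibniz[OF I(1)[OF a(2)] I(1)[OF a(3)] z]
        using a z I by (intro span_add base) auto
    qed
    show "bracket L z x \<in> span ?A"
      using x A z subspace_span
    proof (rule bracket_span_right)
      fix a assume "a \<in> ?A"
      then obtain u v where a: "a = bracket L u v" "u \<in> I" "v \<in> I" by blast
      have "bracket L z a = bracket L (bracket L z u) v - bracket L (bracket L z v) u"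
        using leibniz[OF z I(1)[OF a(2)] I(1)[OF a(3)]] a by simp
      also have "\<dots> \<in> span ?A"
        using a z I by (intro span_diff base) auto
      finally show "bracket L z a \<in> span ?A" .
    qed
  qed
  then show ?thesis
    using span_minimal[OF A subspace_carrier] unfolding ideal_def by auto
qed

lemma ideal_derived_series: "ideal sc L I \<Longrightarrow> ideal sc L (derived_series sc L I m)"
  by (induction m) (auto intro: ideal_span_brackets)

text \<open>This is where \<open>k \<ge> 2\<close> enters: two entries suffice to descend in the derived series.\<close>

lemma iterated_bracket_two_in_ideal:
  assumes "ideal sc L I" "set xs \<subseteq> carrier L" "i < j" "j < length xs" "xs ! i \<in> I" "xs ! j \<in> I"
  shows "nested xs \<in> span {bracket L x y | x y. x \<in> I \<and> y \<in> I}"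
  using assms(2-)
proof (induction xs arbitrary: i j)
  case (Cons a xs)
  have ne: "xs \<noteq> []" and jxs: "j - 1 < length xs" "xs ! (j - 1) \<in> I"
    using Cons.prems by auto
  have xs: "set xs \<subseteq> carrier L" using Cons.prems by auto
  show ?case
  proof (cases "i = 0")
    case True
    moreover have "nested xs \<in> I"
      using iterated_bracket_in_ideal[OF assms(1) xs jxs] .
    ultimately show ?thesis
      using Cons.prems ne by (auto simp: iterated_bracket_Cons intro!: span_base)
  next
    case False
    then have "nested xs \<in> span {bracket L x y | x y. x \<in> I \<and> y \<in> I}"
      using Cons.prems jxs xs Cons.IH[of "i - 1" "j - 1"] by auto
    then show ?thesis
      using ideal_span_brackets[OF assms(1)] Cons.prems ne
      by (auto simp: ideal_def iterated_bracket_Cons)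
  qed
qed simp

lemma iterated_bracket_cong_mod_ideal:
  assumes "ideal sc L K"
    and "list_all2 (\<lambda>x y. x \<in> carrier L \<and> y \<in> carrier L \<and> x - y \<in> K) xs ys"
  shows "nested xs - nested ys \<in> K"
  using assms(2)
proof (induction rule: list_all2_induct)
  case Nil
  then show ?case using assms(1) by (simp add: ideal_def subspace_0)
next
  case (Cons x xs y ys)
  have len: "length xs = length ys" using Cons.hyps by (auto dest: list_all2_lengthD)
  show ?case
  proof (cases "xs = []")
    case True
    then show ?thesis using Cons.hyps len by simp
  next
    case False
    then have ne: "ys \<noteq> []" using len by auto
    have "set xs \<subseteq> carrier L" "set ys \<subseteq> carrier L"
      using Cons.hyps by (auto simp: list_all2_conv_all_nth in_set_conv_nth)
    then have c: "nested xs \<in> carrier L" "nested ys \<in> carrier L"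
      using False ne by (auto intro: iterated_bracket_closed)
    have "bracket L x (nested xs) - bracket L y (nested ys) =
        bracket L (x - y) (nested xs) + bracket L y (nested xs - nested ys)"
      using Cons.hyps c by (intro bracket_diff) auto
    also have "\<dots> \<in> K"
      using Cons c assms(1) unfolding ideal_def by (intro subspace_add) auto
    finally show ?thesis using False ne by (simp add: iterated_bracket_Cons)
  qed
qed

section \<open>Ideals of \<open>L\<close> as ideals of \<open>U n L\<close>\<close>

lemma ideal_imp_n_ideal: "ideal sc L I \<Longrightarrow> n_ideal sc (U n L) I"
  using iterated_bracket_in_ideal unfolding n_ideal_def
  by (auto simp: U_def ideal_def)

lemma zero_in_k_series: "n_ideal sc (U n L) H \<Longrightarrow> 0 \<in> k_series sc (U n L) k H m"
  by (cases m) (auto simp: n_ideal_def subspace_0 span_zero)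

lemma k_series_subset_derived_series:
  assumes "ideal sc L I" "2 \<le> k"
  shows "k_series sc (U n L) k I m \<subseteq> derived_series sc L I m"
proof (induction m)
  case (Suc m)
  let ?D = "derived_series sc L I m"
  have D: "ideal sc L ?D" by (rule ideal_derived_series[OF assms(1)])
  have "nested xs \<in> derived_series sc L I (Suc m)"
    if xs: "length xs = n" "P \<subseteq> {..<n}" "card P = k"
      "\<forall>i<n. xs ! i \<in> (if i \<in> P then k_series sc (U n L) k I m else carrier L)" for xs P
  proof -
    have inD: "xs ! i \<in> ?D" if "i \<in> P" for i
      using xs Suc that by fastforce
    have "set xs \<subseteq> carrier L"
    proof
      fix x assume "x \<in> set xs"
      then obtain i where i: "i < n" "x = xs ! i" using xs(1) by (auto simp: in_set_conv_nth)
      then show "x \<in> carrier L"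
        using xs(4) inD[of i] D by (cases "i \<in> P") (auto simp: ideal_def)
    qed
    moreover obtain i j where "i \<in> P" "j \<in> P" "i < j"
    proof -
      obtain a b where "a \<in> P" "b \<in> P" "a \<noteq> b"
        using xs(3) assms(2) by (metis card_2_iff' obtain_subset_with_card_n subsetD)
      then show thesis using that by (metis linorder_neqE_nat)
    qed
    ultimately show ?thesis
      using iterated_bracket_two_in_ideal[OF D, of xs i j] xs inD by auto
  qed
  then show ?case
    unfolding k_series.simps derived_series.simps(2)
    by (intro span_minimal subspace_span) (auto simp: U_def)
qed simp

lemma solvable_imp_k_solvable:
  assumes "ideal sc L I" "solvable sc L I" "2 \<le> k"
  shows "k_solvable sc (U n L) k I"
  using k_series_subset_derived_series[OF assms(1,3)] assms(2)
    zero_in_k_series[OF ideal_imp_n_ideal[OF assms(1)]]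
  unfolding k_solvable_def solvable_def by (metis insert_subset empty_subsetI subset_antisym)

section \<open>Simple Lie algebras\<close>

lemma simple_imp_perfect:
  assumes "simple sc L"
  shows "span {bracket L x y | x y. x \<in> carrier L \<and> y \<in> carrier L} = carrier L" (is "span ?A = _")
proof -
  have "ideal sc L (carrier L)"
    using subspace_carrier bracket_closed by (auto simp: ideal_def)
  then have "ideal sc L (span ?A)" by (rule ideal_span_brackets)
  moreover obtain x y where "x \<in> carrier L" "y \<in> carrier L" "bracket L x y \<noteq> 0"
    using assms by (auto simp: simple_def)
  then have "span ?A \<noteq> {0}" using span_base[of "bracket L x y" ?A] by blast
  ultimately show ?thesis using assms by (auto simp: simple_def)
qed

lemma perfect_imp_spanned_by_iterated_brackets:
  assumes "span {bracket L x y | x y. x \<in> carrier L \<and> y \<in> carrier L} = carrier L" "1 \<le> n"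
  shows "carrier L \<subseteq> span {nested xs | xs. length xs = n \<and> set xs \<subseteq> carrier L}"
  using assms(2)
proof (induction n rule: nat_induct_at_least)
  case base
  have "x \<in> {nested xs | xs. length xs = 1 \<and> set xs \<subseteq> carrier L}" if "x \<in> carrier L" for x
    using that by (auto intro!: exI[of _ "[x]"])
  then show ?case using span_superset by blast
next
  case (Suc n)
  let ?T = "\<lambda>n. {nested xs | xs. length xs = n \<and> set xs \<subseteq> carrier L}"
  have T: "?T n \<subseteq> carrier L"
    using Suc(1) by (auto intro!: iterated_bracket_closed)
  have "bracket L x y \<in> span (?T (Suc n))" if xy: "x \<in> carrier L" "y \<in> carrier L" for x y
  proof (rule bracket_span_right[OF _ T xy(1) subspace_span])
    show "y \<in> span (?T n)" using Suc xy by blast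
    fix a assume "a \<in> ?T n"
    then obtain xs where xs: "a = nested xs" "length xs = n" "set xs \<subseteq> carrier L" by blast
    then have "bracket L x a = nested (x # xs)"
      using Suc(1) by (subst iterated_bracket_Cons) auto
    then show "bracket L x a \<in> span (?T (Suc n))"
      using xs xy by (intro span_base) (auto intro!: exI[of _ "x # xs"])
  qed
  then have "span {bracket L x y | x y. x \<in> carrier L \<and> y \<in> carrier L} \<subseteq> span (?T (Suc n))"
    by (intro span_minimal subspace_span) blast
  then show ?case using assms(1) by simp
qed

text \<open>Closure of \<open>J\<close> under \<open>t + 1\<close> operators \<open>y \<mapsto> [x, y]\<close> implies closure under \<open>t\<close> of them when
  \<open>t \<ge> 1\<close>, because the commutator of two of these operators is the one of the bracket, and the
  brackets span.  For \<open>t = 1\<close> this says that \<open>J\<close> is an ideal.\<close>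

lemma simple_absorbing_subspace:
  assumes "simple sc L" "subspace J" "J \<subseteq> carrier L" "J \<noteq> {0}" "1 \<le> t"
    and "\<And>xs j. length xs = t \<Longrightarrow> set xs \<subseteq> carrier L \<Longrightarrow> j \<in> J \<Longrightarrow> nested (xs @ [j]) \<in> J"
  shows "J = carrier L"
proof -
  have lie: "lie_algebra sc L" using assms(1) by (simp add: simple_def)
  have perfect: "span {bracket L x y | x y. x \<in> carrier L \<and> y \<in> carrier L} = carrier L"
    (is "span ?A = _") by (rule simple_imp_perfect[OF assms(1)])
  have anti: "bracket L x y = - bracket L y x" if "x \<in> carrier L" "y \<in> carrier L" for x y
  proof -
    have "bracket L (x + y) (x + y) = bracket L x y + bracket L y x"
      using that lie_algebra.bracket_self[OF lie that(1)]
        lie_algebra.bracket_self[OF lie that(2)] subspace_add[OF subspace_carrier that]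
      by (simp add: bracket_add_left bracket_add_right)
    then show ?thesis
      using lie_algebra.bracket_self[OF lie subspace_add[OF subspace_carrier that]]
      by (simp add: eq_neg_iff_add_eq_0)
  qed
  have "\<forall>xs j. length xs = 1 \<longrightarrow> set xs \<subseteq> carrier L \<longrightarrow> j \<in> J \<longrightarrow> nested (xs @ [j]) \<in> J"
    using assms(5,6)
  proof (induction t rule: nat_induct_at_least)
    case base
    then show ?case by blast
  next
    case (Suc t)
    have "nested (xs @ [j]) \<in> J" if h: "length xs = t" "set xs \<subseteq> carrier L" "j \<in> J" for xs j
    proof -
      obtain x ys where xs: "xs = x # ys" using h(1) Suc(1) by (cases xs) auto
      let ?y = "nested (ys @ [j])"
      have y: "?y \<in> carrier L"
        using h xs assms(3) by (intro iterated_bracket_closed) auto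
      have J: "bracket L a (bracket L b ?y) \<in> J" if "a \<in> carrier L" "b \<in> carrier L" for a b
        using Suc.prems[of "a # b # ys" j] that h xs by (simp add: iterated_bracket_Cons)
      have "bracket L x ?y \<in> J"
      proof (rule bracket_span_left[OF _ _ y assms(2)])
        show "x \<in> span ?A" using h xs perfect by auto
        show "?A \<subseteq> carrier L" using bracket_closed by blast
        fix c assume "c \<in> ?A"
        then obtain a b where c: "c = bracket L a b" "a \<in> carrier L" "b \<in> carrier L" by blast
        have "bracket L c ?y = bracket L a (bracket L b ?y) - bracket L b (bracket L a ?y)"
          using leibniz[OF c(2,3) y] anti[OF bracket_closed[OF c(2) y] c(3)] c by simp
        then show "bracket L c ?y \<in> J" using J c subspace_diff[OF assms(2)] by simp
      qed
      then show ?thesis using xs by (simp add: iterated_bracket_Cons)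
    qed
    then show ?case by (rule Suc.IH)
  qed
  from this[rule_format, of "[x]" for x]
  have left: "bracket L x j \<in> J" if "x \<in> carrier L" "j \<in> J" for x j
    using that by simp
  moreover have "bracket L j x \<in> J" if "x \<in> carrier L" "j \<in> J" for x j
    using anti[of j x] left[OF that] that assms(2,3) by (auto simp: subspace_neg)
  ultimately have "ideal sc L J"
    using assms(2,3) by (auto simp: ideal_def)
  then show ?thesis using assms(1,4) by (auto simp: simple_def)
qed

section \<open>Solvable \<open>n\<close>-ideals modulo an ideal with a simple supplement\<close>

text \<open>Since \<open>S\<close> is simple, it meets \<open>K\<close> trivially and is a copy of \<open>L / K\<close>, so the image of \<open>H\<close> in
  \<open>L / K\<close> is described by congruences modulo \<open>K\<close> between elements of \<open>H\<close> and of \<open>S\<close>.  That image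
  is zero, or it is everything and then no term of the \<open>k\<close>-series becomes smaller modulo \<open>K\<close>.\<close>

lemma k_solvable_subset_ideal:
  assumes "2 \<le> n" "k \<le> n" "ideal sc L K"
    and S: "subspace S" "S \<subseteq> carrier L" "simple sc (L\<lparr>carrier := S\<rparr>)" "\<not> S \<subseteq> K"
    and LSK: "carrier L = S + K"
    and H: "n_ideal sc (U n L) H" "k_solvable sc (U n L) k H"
  shows "H \<subseteq> K"
proof (rule ccontr)
  assume notsub: "\<not> H \<subseteq> K"
  interpret S: leibniz_algebra sc "L\<lparr>carrier := S\<rparr>"
    using S(3) by (simp add: simple_def lie_algebra_def)
  have K: "subspace K" "K \<subseteq> carrier L" using assms(3) by (auto simp: ideal_def)
  have subH: "subspace H" "H \<subseteq> carrier L" using H(1) by (auto simp: n_ideal_def U_def)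
  define J where "J = {s \<in> S. \<exists>h\<in>H. h - s \<in> K}"
  have "J = carrier (L\<lparr>carrier := S\<rparr>)"
  proof (rule S.simple_absorbing_subspace[OF S(3), where t = "n - 1"])
    show "subspace J"
      unfolding subspace_def
    proof (intro conjI ballI allI)
      show "0 \<in> J"
        using subspace_0[OF S(1)] subspace_0[OF subH(1)] subspace_0[OF K(1)]
        by (auto simp: J_def intro!: bexI[of _ 0])
      show "x + y \<in> J" if xy: "x \<in> J" "y \<in> J" for x y
      proof -
        obtain a b where ab: "a \<in> H" "a - x \<in> K" "b \<in> H" "b - y \<in> K" and c: "x \<in> S" "y \<in> S"
          using xy by (auto simp: J_def)
        have "(a + b) - (x + y) = (a - x) + (b - y)" by simp
        also have "\<dots> \<in> K" using ab K(1) by (intro subspace_add)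
        finally show ?thesis
          using c ab subspace_add[OF S(1)] subspace_add[OF subH(1)] unfolding J_def by blast
      qed
      show "sc c x \<in> J" if x: "x \<in> J" for c x
      proof -
        obtain a where a: "a \<in> H" "a - x \<in> K" and xS: "x \<in> S"
          using x by (auto simp: J_def)
        have "sc c a - sc c x \<in> K"
          using subspace_scale[OF K(1) a(2), of c] by (simp add: scale_right_diff_distrib)
        then show ?thesis
          using xS a subspace_scale[OF S(1)] subspace_scale[OF subH(1)] unfolding J_def by blast
      qed
    qed
    show "J \<subseteq> carrier (L\<lparr>carrier := S\<rparr>)" by (auto simp: J_def)
    show "J \<noteq> {0}"
    proof
      assume J0: "J = {0}"
      have "h \<in> K" if "h \<in> H" for h
      proof -
        obtain s x where sx: "s \<in> S" "x \<in> K" "h = s + x"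
          using subsetD[OF subH(2) \<open>h \<in> H\<close>] unfolding LSK set_plus_eq by blast
        then have "s \<in> J" using that by (auto simp: J_def intro!: bexI[of _ h])
        then show ?thesis using sx J0 by simp
      qed
      then show False using notsub by blast
    qed
    show "1 \<le> n - 1" using assms(1) by simp
    fix xs j assume h: "length xs = n - 1" "set xs \<subseteq> carrier (L\<lparr>carrier := S\<rparr>)" "j \<in> J"
    obtain a where a: "a \<in> H" "a - j \<in> K" and j: "j \<in> S" using h(3) by (auto simp: J_def)
    have "nested (xs @ [a]) \<in> H"
    proof -
      have "\<forall>ys s. length ys = n \<and> set ys \<subseteq> carrier L \<and> s < n \<and> ys ! s \<in> H \<longrightarrow> nested ys \<in> H"
        using H(1) by (simp add: n_ideal_def U_def)
      from this[rule_format, of "xs @ [a]" "n - 1"] show ?thesis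
        using h S(2) a subH(2) assms(1) by (auto simp: nth_append)
    qed
    moreover have "nested (xs @ [a]) - nested (xs @ [j]) \<in> K"
    proof (rule iterated_bracket_cong_mod_ideal[OF assms(3)])
      have "list_all2 (\<lambda>x y. x \<in> carrier L \<and> y \<in> carrier L \<and> x - y \<in> K) xs xs"
        using h S(2) subspace_0[OF K(1)] by (intro list_all2_same[THEN iffD2]) auto
      then show "list_all2 (\<lambda>x y. x \<in> carrier L \<and> y \<in> carrier L \<and> x - y \<in> K) (xs @ [a]) (xs @ [j])"
        using a j S(2) subH(2) by (intro list_all2_appendI) auto
    qed
    moreover have "nested (xs @ [j]) \<in> S"
      using S.iterated_bracket_closed[of "xs @ [j]"] h j by simp
    ultimately show "iterated_bracket (bracket (L\<lparr>carrier := S\<rparr>)) (xs @ [j]) \<in> J"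
      by (auto simp: J_def)
  qed
  then have SJ: "\<exists>h\<in>H. h - s \<in> K" if "s \<in> S" for s using that by (auto simp: J_def)
  have series_sub: "k_series sc (U n L) k H r \<subseteq> carrier L" for r
  proof (induction r)
    case (Suc r)
    have "nested xs \<in> carrier L" if "length xs = n"
      "\<forall>i<n. xs ! i \<in> (if i \<in> P then k_series sc (U n L) k H r else carrier L)" for xs P
    proof (rule iterated_bracket_closed)
      show "xs \<noteq> []" using that(1) assms(1) by auto
      show "set xs \<subseteq> carrier L"
      proof
        fix x assume "x \<in> set xs"
        then obtain i where "i < n" "x = xs ! i"
          using \<open>length xs = n\<close> by (auto simp: in_set_conv_nth)
        then show "x \<in> carrier L" using that(2)[rule_format, of i] Suc by (cases "i \<in> P") auto
      qed
    qed
    then show ?case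
      unfolding k_series.simps by (intro span_minimal subspace_carrier) (auto simp: U_def)
  qed (use subH in simp)
  \<comment> \<open>Every term of the series still maps onto \<open>L / K\<close>.\<close>
  have all: "\<forall>s\<in>S. \<exists>h\<in>k_series sc (U n L) k H r. h - s \<in> K" for r
  proof (induction r)
    case 0
    then show ?case using SJ by simp
  next
    case (Suc r)
    let ?N = "k_series sc (U n L) k H (Suc r)" and ?M = "k_series sc (U n L) k H r"
    have N: "subspace ?N" by simp
    have "S \<subseteq> span {nested xs | xs. length xs = n \<and> set xs \<subseteq> S}"
      using S.perfect_imp_spanned_by_iterated_brackets[OF S.simple_imp_perfect[OF S(3)], of n]
        assms(1) by simp
    also have "\<dots> \<subseteq> ?N + K"
    proof (rule span_minimal)
      show "subspace (?N + K)" by (rule subspace_set_plus[OF N K(1)])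
      show "{nested xs | xs. length xs = n \<and> set xs \<subseteq> S} \<subseteq> ?N + K"
      proof
        fix z assume "z \<in> {nested xs | xs. length xs = n \<and> set xs \<subseteq> S}"
        then obtain xs where z: "z = nested xs" and xs: "length xs = n" "set xs \<subseteq> S" by blast
        obtain f where f: "\<And>s. s \<in> S \<Longrightarrow> f s \<in> ?M \<and> f s - s \<in> K"
          using Suc by metis
        let ?ys = "map f xs"
        have fL: "f s \<in> carrier L" if "s \<in> S" for s using f[OF that] series_sub by blast
        \<comment> \<open>All entries of \<open>?ys\<close> are in \<open>?M\<close>, so any \<open>k\<close> positions serve; take the first ones.\<close>
        have "nested ?ys \<in> ?N"
          unfolding k_series.simps
        proof (rule span_base, rule CollectI, intro exI conjI)
          show "nested ?ys = nbracket (U n L) ?ys" by (simp add: U_def)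
          show "length ?ys = arity (U n L)" using xs by (simp add: U_def)
          show "{..<k} \<subseteq> {..<arity (U n L)}" using assms(2) by (auto simp: U_def)
          show "card {..<k} = k" by simp
          show "\<forall>i<arity (U n L). ?ys ! i \<in> (if i \<in> {..<k} then ?M else carrier (U n L))"
          proof (intro allI impI)
            fix i assume "i < arity (U n L)"
            then have i: "i < length xs" and "xs ! i \<in> S" using xs by (auto simp: U_def)
            moreover have "carrier (U n L) = carrier L" by (simp add: U_def)
            ultimately show "?ys ! i \<in> (if i \<in> {..<k} then ?M else carrier (U n L))"
              using f[of "xs ! i"] fL[of "xs ! i"] by simp
          qed
        qed
        moreover have "nested xs - nested ?ys \<in> K"
        proof (rule iterated_bracket_cong_mod_ideal[OF assms(3)])
          have "s - f s \<in> K" if "s \<in> S" for s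
            using subspace_neg[OF K(1), of "f s - s"] f[OF that] by simp
          then show "list_all2 (\<lambda>x y. x \<in> carrier L \<and> y \<in> carrier L \<and> x - y \<in> K) xs ?ys"
            using xs S(2) fL by (auto simp: list_all2_conv_all_nth subset_iff)
        qed
        ultimately have "nested ?ys + (nested xs - nested ?ys) \<in> ?N + K"
          by (rule set_plus_intro)
        then show "z \<in> ?N + K" by (simp add: z)
      qed
    qed
    finally have sub: "S \<subseteq> ?N + K" .
    show ?case
    proof
      fix s assume "s \<in> S"
      then obtain h x where hx: "h \<in> ?N" "x \<in> K" "s = h + x"
        using sub unfolding set_plus_eq by blast
      then have "h - s \<in> K" using subspace_neg[OF K(1), of x] by simp
      then show "\<exists>h\<in>?N. h - s \<in> K" using hx(1) by blast
    qed
  qed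
  obtain r where "k_series sc (U n L) k H r = {0}" using H(2) by (auto simp: k_solvable_def)
  then have "- s \<in> K" if "s \<in> S" for s using all[of r] that by auto
  then show False using S(4) subspace_neg[OF K(1)] by force
qed

end

section \<open>The Levi decomposition of \<open>U n L\<close>\<close>

lemma iterated_bracket_componentwise:
  assumes "\<And>f f'. (\<forall>i\<in>I. f i \<in> g i \<and> f' i \<in> g i) \<Longrightarrow>
      b (\<Sum>i\<in>I. f i) (\<Sum>i\<in>I. f' i) = (\<Sum>i\<in>I. b (f i) (f' i))"
    and "\<And>i x y. i \<in> I \<Longrightarrow> x \<in> g i \<Longrightarrow> y \<in> g i \<Longrightarrow> b x y \<in> g i"
    and "fs \<noteq> []" "\<forall>f\<in>set fs. \<forall>i\<in>I. f i \<in> g i"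
  shows "iterated_bracket b (map (\<lambda>f. \<Sum>i\<in>I. f i) fs) =
      (\<Sum>i\<in>I. iterated_bracket b (map (\<lambda>f. f i) fs)) \<and>
    (\<forall>i\<in>I. iterated_bracket b (map (\<lambda>f. f i) fs) \<in> g i)"
  using assms(3,4)
proof (induction fs)
  case (Cons f fs)
  show ?case
  proof (cases fs)
    case Nil
    then show ?thesis using Cons.prems by simp
  next
    case (Cons f' fs')
    then show ?thesis
      using Cons.IH Cons.prems assms(2)
        assms(1)[of f "\<lambda>i. iterated_bracket b (map (\<lambda>f. f i) fs)"] by simp
  qed
qed simp

theorem theorem3p12:
  fixes sc :: "'k::field_char_0 \<Rightarrow> 'v::ab_group_add \<Rightarrow> 'v"
    and L :: "'v lalg" and G :: "'v set" and g :: "nat \<Rightarrow> 'v set" and m n :: nat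
  assumes "2 \<le> n"
    and "leibniz_algebra sc L"
    and "finite_dim sc (carrier L)"
    and "levi_decomposition sc L G"
    and "\<And>i. i \<in> {1..m} \<Longrightarrow> subalgebra sc (L\<lparr>carrier := G\<rparr>) (g i)"
    and "\<And>i. i \<in> {1..m} \<Longrightarrow> simple sc (L\<lparr>carrier := g i\<rparr>)"
    and "direct_sum_in sc (L\<lparr>carrier := G\<rparr>) {1..m} (\<lambda>i. L\<lparr>carrier := g i\<rparr>)"
    and "G = (\<Sum>i\<in>{1..m}. g i)"
  shows "(\<forall>k\<in>{2..n}. is_k_radical sc (U n L) k (k_Rad sc k (U n L)) \<and>
            k_Rad sc k (U n L) = rad sc L) \<and>
         n_direct_sum_in sc (U n L) {1..m} (\<lambda>i. U n (L\<lparr>carrier := g i\<rparr>)) \<and>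
         carrier (U n L) =
           (\<Sum>i\<in>{1..m}. carrier (U n (L\<lparr>carrier := g i\<rparr>))) + Rad sc (U n L)"
proof -
  interpret leibniz_algebra sc L by fact
  let ?I = "{1..m}"
  define R where "R = rad sc L"
  have radR: "is_radical sc L R" unfolding R_def by (rule is_radical_rad) fact
  have idR: "ideal sc L R" and solR: "solvable sc L R" using radR by (auto simp: is_radical_def)
  have R: "subspace R" "R \<subseteq> carrier L" using idR by (auto simp: ideal_def)
  have Gsub: "subspace G" "G \<subseteq> carrier L" and LGR: "carrier L = G + R" and GR: "G \<inter> R = {0}"
    using assms(4) by (auto simp: levi_decomposition_def subalgebra_def R_def)
  have gsub: "subspace (g i)" "g i \<subseteq> G" "\<And>x y. x \<in> g i \<Longrightarrow> y \<in> g i \<Longrightarrow> bracket L x y \<in> g i"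
    if "i \<in> ?I" for i
    using assms(5)[OF that] by (auto simp: subalgebra_def)
  have indep: "\<And>f. (\<forall>i\<in>?I. f i \<in> g i) \<Longrightarrow> (\<Sum>i\<in>?I. f i) = 0 \<Longrightarrow> \<forall>i\<in>?I. f i = 0"
    and comp: "\<And>f f'. (\<forall>i\<in>?I. f i \<in> g i \<and> f' i \<in> g i) \<Longrightarrow>
      bracket L (\<Sum>i\<in>?I. f i) (\<Sum>i\<in>?I. f' i) = (\<Sum>i\<in>?I. bracket L (f i) (f' i))"
    using assms(7) unfolding direct_sum_in_def independent_family_def by auto
  have sumG: "(\<Sum>i\<in>?I. f i) \<in> G" if "\<forall>i\<in>?I. f i \<in> g i" for f
    using that gsub(2) by (intro subspace_sum[OF Gsub(1)]) blast
  have decomp: "\<exists>f r. (\<forall>i\<in>?I. f i \<in> g i) \<and> r \<in> R \<and> x = (\<Sum>i\<in>?I. f i) + r"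
    if "x \<in> carrier L" for x
  proof -
    obtain y r where "y \<in> G" "r \<in> R" "x = y + r" using \<open>x \<in> carrier L\<close> unfolding LGR set_plus_eq by blast
    moreover obtain f where "y = (\<Sum>i\<in>?I. f i)" "\<forall>i\<in>?I. f i \<in> g i"
      using \<open>y \<in> G\<close> assms(8) by (auto simp: set_sum_alt)
    ultimately show ?thesis by blast
  qed
  have unique: "f i = f' i"
    if "\<forall>i\<in>?I. f i \<in> g i" "\<forall>i\<in>?I. f' i \<in> g i" "r \<in> R" "r' \<in> R" "i \<in> ?I"
      "(\<Sum>i\<in>?I. f i) + r = (\<Sum>i\<in>?I. f' i) + r'" for f f' r r' i
  proof -
    have d: "\<forall>i\<in>?I. f i - f' i \<in> g i" using that gsub(1) subspace_diff by blast
    have "(\<Sum>i\<in>?I. f i - f' i) = r' - r"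
      using that(6) by (simp add: sum_subtractf algebra_simps)
    then have "(\<Sum>i\<in>?I. f i - f' i) \<in> G \<inter> R"
      using sumG[OF d] that R(1) subspace_diff by auto
    then show ?thesis using indep[OF d] GR that(5) by auto
  qed
  \<comment> \<open>The ideal \<open>K i\<close> is the kernel of the projection of \<open>L\<close> onto its component \<open>g i\<close>.\<close>
  define K where
    "K i = {(\<Sum>j\<in>?I. f j) + r | f r. (\<forall>j\<in>?I. f j \<in> g j) \<and> r \<in> R \<and> f i = 0}" for i
  have KI: "x \<in> K i" if "\<forall>j\<in>?I. f j \<in> g j" "r \<in> R" "f i = 0" "x = (\<Sum>j\<in>?I. f j) + r" for x f r i
    using that unfolding K_def by blast
  have idK: "ideal sc L (K i)" if i: "i \<in> ?I" for i
    unfolding ideal_def subspace_def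
  proof (intro conjI ballI allI)
    show "0 \<in> K i"
      using gsub(1) R(1) by (intro KI[of "\<lambda>_. 0" 0]) (auto simp: subspace_0)
    show "x + y \<in> K i" if "x \<in> K i" "y \<in> K i" for x y
    proof -
      obtain f r f' r' where "x = (\<Sum>j\<in>?I. f j) + r" "\<forall>j\<in>?I. f j \<in> g j" "r \<in> R" "f i = 0"
        "y = (\<Sum>j\<in>?I. f' j) + r'" "\<forall>j\<in>?I. f' j \<in> g j" "r' \<in> R" "f' i = 0"
        using \<open>x \<in> K i\<close> \<open>y \<in> K i\<close> unfolding K_def by blast
      then show ?thesis
        using gsub(1) R(1)
        by (intro KI[of "\<lambda>j. f j + f' j" "r + r'"])
          (auto simp: subspace_add sum.distrib algebra_simps)
    qed
    show "sc c x \<in> K i" if "x \<in> K i" for c x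
    proof -
      obtain f r where "x = (\<Sum>j\<in>?I. f j) + r" "\<forall>j\<in>?I. f j \<in> g j" "r \<in> R" "f i = 0"
        using \<open>x \<in> K i\<close> unfolding K_def by blast
      then show ?thesis
        using gsub(1) R(1)
        by (intro KI[of "\<lambda>j. sc c (f j)" "sc c r"])
          (auto simp: subspace_scale scale_sum_right scale_right_distrib)
    qed
    show KL: "K i \<subseteq> carrier L"
      using sumG R Gsub subspace_add[OF subspace_carrier] unfolding K_def by blast
    fix x y assume x: "x \<in> K i" and y: "y \<in> carrier L"
    obtain f r where f: "x = (\<Sum>j\<in>?I. f j) + r" "\<forall>j\<in>?I. f j \<in> g j" "r \<in> R" "f i = 0"
      using x unfolding K_def by blast
    obtain f' r' where f': "y = (\<Sum>j\<in>?I. f' j) + r'" "\<forall>j\<in>?I. f' j \<in> g j" "r' \<in> R"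
      using decomp[OF y] by blast
    let ?s = "\<Sum>j\<in>?I. f j" and ?s' = "\<Sum>j\<in>?I. f' j"
    have c: "?s \<in> carrier L" "?s' \<in> carrier L" "r \<in> carrier L" "r' \<in> carrier L"
      using sumG f f' Gsub(2) R(2) by blast+
    have abs: "bracket L a z \<in> R" "bracket L z a \<in> R" if "a \<in> R" "z \<in> carrier L" for a z
      using idR that by (auto simp: ideal_def)
    have fi: "f' i \<in> carrier L" using f'(2) i gsub(2) Gsub(2) by blast
    show "bracket L x y \<in> K i"
    proof (rule KI)
      show "\<forall>j\<in>?I. bracket L (f j) (f' j) \<in> g j" using f f' gsub(3) by blast
      show "bracket L ?s r' + bracket L r y \<in> R"
        using c f f' y by (intro subspace_add[OF R(1)] abs)
      show "bracket L (f i) (f' i) = 0" using f(4) fi by (simp add: bracket_zero_left)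
      have "bracket L x y = bracket L ?s (?s' + r') + bracket L r y"
        using c y f(1) f'(1) by (simp add: bracket_add_left subspace_add[OF subspace_carrier])
      also have "bracket L ?s (?s' + r') = bracket L ?s ?s' + bracket L ?s r'"
        using c by (intro bracket_add_right)
      finally show "bracket L x y =
          (\<Sum>j\<in>?I. bracket L (f j) (f' j)) + (bracket L ?s r' + bracket L r y)"
        using comp[of f f'] f f' by (simp add: add.assoc)
    qed
    show "bracket L y x \<in> K i"
    proof (rule KI)
      show "\<forall>j\<in>?I. bracket L (f' j) (f j) \<in> g j" using f f' gsub(3) by blast
      show "bracket L ?s' r + bracket L r' x \<in> R"
        using c f f' x KL by (intro subspace_add[OF R(1)] abs) auto
      show "bracket L (f' i) (f i) = 0" using f(4) fi by (simp add: bracket_zero_right)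
      have "bracket L y x = bracket L ?s' (?s + r) + bracket L r' x"
        using c f(1) f'(1) by (simp add: bracket_add_left subspace_add[OF subspace_carrier])
      also have "bracket L ?s' (?s + r) = bracket L ?s' ?s + bracket L ?s' r"
        using c by (intro bracket_add_right)
      finally show "bracket L y x =
          (\<Sum>j\<in>?I. bracket L (f' j) (f j)) + (bracket L ?s' r + bracket L r' x)"
        using comp[of f' f] f f' by (simp add: add.assoc)
    qed
  qed
  have single: "(\<Sum>j\<in>?I. (if j = i then x else 0)) = x" if "i \<in> ?I" for i and x :: 'v
    using that by (simp add: sum.delta)
  have LgK: "carrier L = g i + K i" if i: "i \<in> ?I" for i
  proof
    show "carrier L \<subseteq> g i + K i"
    proof
      fix x assume "x \<in> carrier L"
      then obtain f r where f: "\<forall>j\<in>?I. f j \<in> g j" "r \<in> R" "x = (\<Sum>j\<in>?I. f j) + r"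
        using decomp by blast
      have "(\<Sum>j\<in>?I. (f(i := 0)) j) = (\<Sum>j\<in>?I. f j - (if j = i then f i else 0))"
        by (intro sum.cong) auto
      also have "\<dots> = (\<Sum>j\<in>?I. f j) - f i"
        unfolding sum_subtractf single[OF i] by simp
      finally have "(\<Sum>j\<in>?I. (f(i := 0)) j) = (\<Sum>j\<in>?I. f j) - f i" .
      then have "x - f i \<in> K i"
        using f gsub(1) by (intro KI[of "f(i := 0)" r]) (auto simp: subspace_0)
      then have "f i + (x - f i) \<in> g i + K i" using f i by (intro set_plus_intro) auto
      then show "x \<in> g i + K i" by simp
    qed
    show "g i + K i \<subseteq> carrier L"
      using idK[OF i] gsub(2)[OF i] Gsub(2) subspace_add[OF subspace_carrier]
      unfolding ideal_def set_plus_eq by blast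
  qed
  have gK: "\<not> g i \<subseteq> K i" if i: "i \<in> ?I" for i
  proof
    assume sub: "g i \<subseteq> K i"
    have zero: "x = 0" if x: "x \<in> g i" for x
    proof -
      obtain f r where f: "x = (\<Sum>j\<in>?I. f j) + r" "\<forall>j\<in>?I. f j \<in> g j" "r \<in> R" "f i = 0"
        using x sub unfolding K_def by blast
      have "(if i = i then x else 0) = f i"
        using x f i gsub(1) single[OF i, of x] subspace_0 R(1)
        by (intro unique[of "\<lambda>j. if j = i then x else 0" f 0 r i]) auto
      then show ?thesis using f by simp
    qed
    show False
      using assms(6)[OF i] zero gsub(3)[OF i] unfolding simple_def by fastforce
  qed
  have max: "H \<subseteq> R" if k: "k \<in> {2..n}" and H: "n_ideal sc (U n L) H" "k_solvable sc (U n L) k H"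
    for H k
  proof
    fix h assume h: "h \<in> H"
    have HK: "h \<in> K i" if i: "i \<in> ?I" for i
      using k_solvable_subset_ideal[OF assms(1) _ idK[OF i] gsub(1)[OF i] _ assms(6)[OF i]
          gK[OF i] LgK[OF i] H] k gsub(2)[OF i] Gsub(2) h by auto
    have "h \<in> carrier L" using H(1) h by (auto simp: n_ideal_def U_def)
    then obtain f r where f: "\<forall>j\<in>?I. f j \<in> g j" "r \<in> R" "h = (\<Sum>j\<in>?I. f j) + r"
      using decomp by blast
    have "f i = 0" if i: "i \<in> ?I" for i
    proof -
      obtain f' r' where f': "h = (\<Sum>j\<in>?I. f' j) + r'" "\<forall>j\<in>?I. f' j \<in> g j" "r' \<in> R" "f' i = 0"
        using HK[OF i] unfolding K_def by blast
      then show ?thesis using unique[of f f' r r' i] f i by simp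
    qed
    then show "h \<in> R" using f by simp
  qed
  have krad: "is_k_radical sc (U n L) k R" if "k \<in> {2..n}" for k
    using that max ideal_imp_n_ideal[OF idR] solvable_imp_k_solvable[OF idR solR]
    unfolding is_k_radical_def by auto
  have kR: "k_Rad sc k (U n L) = R" if "k \<in> {2..n}" for k
    by (rule k_Rad_eqI[OF krad[OF that]])
  have "n_direct_sum_in sc (U n L) ?I (\<lambda>i. U n (L\<lparr>carrier := g i\<rparr>))"
    unfolding n_direct_sum_in_def
  proof (intro conjI ballI allI impI)
    fix i assume i: "i \<in> ?I"
    interpret S: leibniz_algebra sc "L\<lparr>carrier := g i\<rparr>"
      using assms(6)[OF i] by (simp add: simple_def lie_algebra_def)
    show "leibniz_n_algebra sc (U n (L\<lparr>carrier := g i\<rparr>))"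
      by (rule S.U_leibniz_n_algebra[OF assms(1)])
    show "arity (U n (L\<lparr>carrier := g i\<rparr>)) = arity (U n L)" by (simp add: U_def)
    show "carrier (U n (L\<lparr>carrier := g i\<rparr>)) \<subseteq> carrier (U n L)"
      using gsub(2)[OF i] Gsub(2) by (auto simp: U_def)
  next
    show "independent_family ?I (\<lambda>i. carrier (U n (L\<lparr>carrier := g i\<rparr>)))"
      using indep by (auto simp: independent_family_def U_def)
  next
    fix fs :: "(nat \<Rightarrow> 'v) list"
    assume fs: "length fs = arity (U n L) \<and>
      (\<forall>f\<in>set fs. \<forall>i\<in>?I. f i \<in> carrier (U n (L\<lparr>carrier := g i\<rparr>)))"
    then have "fs \<noteq> []" "\<forall>f\<in>set fs. \<forall>i\<in>?I. f i \<in> g i" using assms(1) by (auto simp: U_def)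
    then show "nbracket (U n L) (map (\<lambda>f. \<Sum>i\<in>?I. f i) fs) =
        (\<Sum>i\<in>?I. nbracket (U n (L\<lparr>carrier := g i\<rparr>)) (map (\<lambda>f. f i) fs))"
      using iterated_bracket_componentwise[of ?I g "bracket L" fs] comp gsub(3)
      by (simp add: U_def)
  qed
  moreover have "carrier (U n L) =
      (\<Sum>i\<in>?I. carrier (U n (L\<lparr>carrier := g i\<rparr>))) + Rad sc (U n L)"
    using LGR assms(1,8) kR[of n] by (simp add: Rad_def U_def)
  ultimately show ?thesis using krad kR by (simp add: R_def)
qed

end
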